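(* Let $X_1,X_2\subset\mathbb Z^m$ be digital images with adjacency $\kappa$ and $Y_1,Y_2\subset\mathbb Z^n$ digital images with adjacency $\lambda$. Suppose $X=X_1\wedge X_2$ is a wedge with wedge point $x_0$ and $Y=Y_1\wedge Y_2$ is a wedge with wedge point $y_0$. If $(X_1,x_0)\simeq^L_{\kappa,\lambda}(Y_1,y_0)$ and $(X_2,x_0)\simeq^L_{\kappa,\lambda}(Y_2,y_0)$, then $(X,x_0)\simeq^L_{\kappa,\lambda}(Y,y_0)$.
   Context: A digital image $(X,\kappa)$ is a set $X\subset\mathbb Z^n$ (for some $n\ge 1$) with an adjacency relation $\kappa$ (a symmetric, irreflexive relation). A subset is $\kappa$-connected if any two distinct points of it are joined by a finite sequence of points of the subset whose consecutive members are $\kappa$-adjacent. A function $f:(X,\kappa)\to(Y,\lambda)$ is $(\kappa,\lambda)$-continuous if it maps $\kappa$-connected sets to $\lambda$-connected sets; equivalently, $\kappa$-adjacent points are mapped to equal or $\lambda$-adjacent points. $\mathbb N=\{1,2,\dots\}$; $\mathbb Z$ carries the adjacency in which consecutive integers are adjacent. Long homotopy: for continuous $f,g:(X,\kappa)\to(Y,\lambda)$, a long homotopy from $f$ to $g$ is $F:X\times\mathbb Z\to Y$ such that for each $x\in X$ there is $N_{F,x}\in\mathbb N$ with $F(x,t)=f(x)$ for $t\le -N_{F,x}$ and $F(x,t)=g(x)$ for $t\ge N_{F,x}$; for each $x\in X$ the function $t\mapsto F(x,t)$ is continuous on $\mathbb Z$; and for each $t\in\mathbb Z$ the function $x\mapsto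 F(x,t)$ is $(\kappa,\lambda)$-continuous. Then $f\simeq^L g$. It is pointed with respect to $x_0\in X$, $y_0\in Y$ if $F(x_0,t)=y_0$ for all $t\in\mathbb Z$. $(X,x_0)\simeq^L_{\kappa,\lambda}(Y,y_0)$ (same pointed long homotopy type) means there are continuous $f:X\to Y$, $g:Y\to X$ with $f(x_0)=y_0$, $g(y_0)=x_0$, and long homotopies $g\circ f\simeq^L 1_X$ holding $x_0$ fixed and $f\circ g\simeq^L1_Y$ holding $y_0$ fixed. Wedge: if $X_1,X_2\subset\mathbb Z^m$ carry the same adjacency $\kappa$, $X_1\cap X_2=\{x_0\}$, and no point of $X_1\setminus\{x_0\}$ is $\kappa$-adjacent to a point of $X_2\setminus\{x_0\}$, then $X=X_1\cup X_2$ with adjacency $\kappa$ is the wedge $X_1\wedge X_2$, with wedge point $x_0$. *)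

theory Defs
  imports "HOL-Analysis.Finite_Cartesian_Product"
begin

text \<open>
  Digital images are carrier sets equipped with an adjacency relation on the ambient type.
  The definitions are polymorphic so that they cover subsets of
  \<^typ>\<open>int ^ 'n\<close> as well as the integer line \<^typ>\<open>int\<close>. Functions between images are
  total HOL functions of which only the values on the carrier matter.
\<close>

definition digital_image :: "'a set \<Rightarrow> ('a \<Rightarrow> 'a \<Rightarrow> bool) \<Rightarrow> bool" where
  "digital_image X \<kappa> \<longleftrightarrow> symp_on X \<kappa> \<and> irreflp_on X \<kappa>"

definition digitally_connected :: "('a \<Rightarrow> 'a \<Rightarrow> bool) \<Rightarrow> 'a set \<Rightarrow> bool" where
  "digitally_connected \<kappa> A \<longleftrightarrow>
     (\<forall>x\<in>A. \<forall>y\<in>A. x \<noteq> y \<longrightarrow>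
        (\<exists>p. p \<noteq> [] \<and> set p \<subseteq> A \<and> hd p = x \<and> last p = y \<and> successively \<kappa> p))"

definition digitally_continuous ::
  "'a set \<Rightarrow> ('a \<Rightarrow> 'a \<Rightarrow> bool) \<Rightarrow> 'b set \<Rightarrow> ('b \<Rightarrow> 'b \<Rightarrow> bool) \<Rightarrow> ('a \<Rightarrow> 'b) \<Rightarrow> bool" where
  "digitally_continuous X \<kappa> Y \<mu> f \<longleftrightarrow>
     f ` X \<subseteq> Y \<and>
     (\<forall>A\<subseteq>X. digitally_connected \<kappa> A \<longrightarrow> digitally_connected \<mu> (f ` A))"

definition int_adj :: "int \<Rightarrow> int \<Rightarrow> bool" where
  "int_adj s t \<longleftrightarrow> \<bar>s - t\<bar> = 1"

definition long_homotopy ::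
  "'a set \<Rightarrow> ('a \<Rightarrow> 'a \<Rightarrow> bool) \<Rightarrow> 'b set \<Rightarrow> ('b \<Rightarrow> 'b \<Rightarrow> bool) \<Rightarrow>
   ('a \<Rightarrow> 'b) \<Rightarrow> ('a \<Rightarrow> 'b) \<Rightarrow> ('a \<Rightarrow> int \<Rightarrow> 'b) \<Rightarrow> bool" where
  "long_homotopy X \<kappa> Y \<mu> f g F \<longleftrightarrow>
     digitally_continuous X \<kappa> Y \<mu> f \<and>
     digitally_continuous X \<kappa> Y \<mu> g \<and>
     (\<forall>x\<in>X. \<exists>N::nat. N \<ge> 1 \<and>
        (\<forall>t. t \<le> - int N \<longrightarrow> F x t = f x) \<and>
        (\<forall>t. t \<ge> int N \<longrightarrow> F x t = g x)) \<and>
     (\<forall>x\<in>X. digitally_continuous UNIV int_adj Y \<mu> (\<lambda>t. F x t)) \<and>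
     (\<forall>t. digitally_continuous X \<kappa> Y \<mu> (\<lambda>x. F x t))"

definition pointed_long_homotopic ::
  "'a set \<Rightarrow> ('a \<Rightarrow> 'a \<Rightarrow> bool) \<Rightarrow> 'a \<Rightarrow> 'b set \<Rightarrow> ('b \<Rightarrow> 'b \<Rightarrow> bool) \<Rightarrow> 'b \<Rightarrow>
   ('a \<Rightarrow> 'b) \<Rightarrow> ('a \<Rightarrow> 'b) \<Rightarrow> bool" where
  "pointed_long_homotopic X \<kappa> x0 Y \<mu> y0 f g \<longleftrightarrow>
     x0 \<in> X \<and> y0 \<in> Y \<and>
     (\<exists>F. long_homotopy X \<kappa> Y \<mu> f g F \<and> (\<forall>t. F x0 t = y0))"

definition same_pointed_long_homotopy_type ::
  "'a set \<Rightarrow> ('a \<Rightarrow> 'a \<Rightarrow> bool) \<Rightarrow> 'a \<Rightarrow> 'b set \<Rightarrow> ('b \<Rightarrow> 'b \<Rightarrow> bool) \<Rightarrow> 'b \<Rightarrow> bool" where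
  "same_pointed_long_homotopy_type X \<kappa> x0 Y \<mu> y0 \<longleftrightarrow>
     x0 \<in> X \<and> y0 \<in> Y \<and>
     (\<exists>f g. digitally_continuous X \<kappa> Y \<mu> f \<and> digitally_continuous Y \<mu> X \<kappa> g \<and>
        f x0 = y0 \<and> g y0 = x0 \<and>
        pointed_long_homotopic X \<kappa> x0 X \<kappa> x0 (g \<circ> f) id \<and>
        pointed_long_homotopic Y \<mu> y0 Y \<mu> y0 (f \<circ> g) id)"

text \<open>
  Non-adjacency across the wedge is required in both directions, because being a digital image
  is a condition on each of the two sets separately and so does not by itself force symmetry of
  the relation between them.
\<close>

definition digital_wedge ::
  "('a \<Rightarrow> 'a \<Rightarrow> bool) \<Rightarrow> 'a set \<Rightarrow> 'a set \<Rightarrow> 'a \<Rightarrow> 'a set \<Rightarrow> bool" where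
  "digital_wedge \<kappa> X1 X2 x0 X \<longleftrightarrow>
     X1 \<inter> X2 = {x0} \<and>
     (\<forall>x\<in>X1 - {x0}. \<forall>y\<in>X2 - {x0}. \<not> \<kappa> x y \<and> \<not> \<kappa> y x) \<and>
     X = X1 \<union> X2"

lemma digital_image_wedge:
  assumes "digital_image X1 \<kappa>" "digital_image X2 \<kappa>" "digital_wedge \<kappa> X1 X2 x0 X"
  shows "digital_image X \<kappa>"
  using assms unfolding digital_image_def digital_wedge_def symp_on_def irreflp_on_def
  by (metis Diff_iff IntD1 IntD2 Un_iff insertI1 singletonD)

end

theory Submission imports Defs begin

text \<open>
  Two pointed maps defined on the two halves of a wedge glue to a continuous map, because adjacent
  points of a wedge always lie in a common half. Gluing the given homotopy equivalences and, for
  each time, the given homotopies proves the theorem: since the homotopies hold the wedge point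
  fixed, they agree where the halves meet.
\<close>

section \<open>Continuity expressed through adjacent pairs\<close>

lemma digitally_connected_pair:
  assumes "\<kappa> x y" "\<kappa> y x"
  shows "digitally_connected \<kappa> {x, y}"
proof -
  have "\<exists>p. p \<noteq> [] \<and> set p \<subseteq> {x, y} \<and> hd p = u \<and> last p = v \<and> successively \<kappa> p"
    if "u \<in> {x, y}" "v \<in> {x, y}" "u \<noteq> v" for u v
    using that assms by (intro exI[of _ "[u, v]"]) (elim insertE emptyE; simp)
  then show ?thesis
    unfolding digitally_connected_def by blast
qed

text \<open>The first step of the path away from \<open>a\<close> gives the required
  \<open>b\<close>. The path may linger at \<open>a\<close> before that step, since
  \<open>\<mu>\<close> is an arbitrary relation here.\<close>

lemma successively_leaves:
  assumes "successively \<mu> p" "p \<noteq> []" "hd p = a" "last p \<noteq> a"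
  shows "\<exists>b \<in> set p. b \<noteq> a \<and> \<mu> a b"
  using assms
proof (induction p)
  case (Cons c p)
  then show ?case
    by (cases p) (auto split: if_splits)
qed simp

text \<open>A path from \<open>a\<close> to \<open>b\<close> inside \<open>{a, b}\<close> must leave
  \<open>a\<close>, and the only point it can step to is \<open>b\<close>.\<close>

lemma digitally_connected_pairD:
  assumes "digitally_connected \<mu> {a, b}" "a \<noteq> b"
  shows "\<mu> a b"
proof -
  obtain p where "p \<noteq> []" "set p \<subseteq> {a, b}" "hd p = a" "last p = b" "successively \<mu> p"
    using assms unfolding digitally_connected_def by blast
  then show ?thesis
    using successively_leaves[of \<mu> p a] assms(2) by auto
qed

text \<open>Images of paths under continuous maps may stand still for some steps. Collapsing each
  run of equal entries leaves only the genuine steps.\<close>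

lemma successively_remdups_adj_reflclp:
  "successively (\<lambda>a b. a = b \<or> P a b) xs \<Longrightarrow> successively P (remdups_adj xs)"
  by (induction xs rule: remdups_adj.induct) (auto simp: successively_Cons)

text \<open>Push a path forward along \<open>f\<close> and delete the steps that \<open>f\<close>
  collapses; \<open>remdups_adj\<close> keeps both endpoints and the set of visited points.\<close>

lemma digitally_connected_image:
  assumes conn: "digitally_connected \<kappa> A"
    and adj: "\<And>x y. x \<in> A \<Longrightarrow> y \<in> A \<Longrightarrow> \<kappa> x y \<Longrightarrow> f x = f y \<or> \<mu> (f x) (f y)"
  shows "digitally_connected \<mu> (f ` A)"
  unfolding digitally_connected_def
proof (intro ballI impI)
  fix u v assume "u \<in> f ` A" "v \<in> f ` A" "u \<noteq> v"
  then obtain x y where xy: "x \<in> A" "y \<in> A" "x \<noteq> y" "u = f x" "v = f y"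
    by auto
  then obtain p where p: "p \<noteq> []" "set p \<subseteq> A" "hd p = x" "last p = y" "successively \<kappa> p"
    using conn unfolding digitally_connected_def by blast
  have "successively (\<lambda>a b. f a = f b \<or> \<mu> (f a) (f b)) p"
    using p(5) by (rule successively_mono) (use p(2) adj in blast)
  then have "successively (\<lambda>a b. a = b \<or> \<mu> a b) (map f p)"
    by (simp add: successively_map)
  then have "successively \<mu> (remdups_adj (map f p))"
    by (rule successively_remdups_adj_reflclp)
  then show "\<exists>q. q \<noteq> [] \<and> set q \<subseteq> f ` A \<and> hd q = u \<and> last q = v \<and> successively \<mu> q"
    using p xy
    by (intro exI[of _ "remdups_adj (map f p)"]) (auto simp: hd_map last_map)
qed

text \<open>From left to right, continuity is tested on the two-point sets \<open>{x, y}\<close>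
  with \<open>x\<close> and \<open>y\<close> adjacent, which are connected by symmetry of
  \<open>\<kappa>\<close>. From right to left, paths are pushed forward.\<close>

lemma digitally_continuous_iff_adj:
  assumes "symp_on X \<kappa>"
  shows "digitally_continuous X \<kappa> Y \<mu> f \<longleftrightarrow>
    f ` X \<subseteq> Y \<and> (\<forall>x\<in>X. \<forall>y\<in>X. \<kappa> x y \<longrightarrow> f x = f y \<or> \<mu> (f x) (f y))"
proof
  assume cont: "digitally_continuous X \<kappa> Y \<mu> f"
  have "f x = f y \<or> \<mu> (f x) (f y)" if "x \<in> X" "y \<in> X" "\<kappa> x y" for x y
  proof -
    have "digitally_connected \<kappa> {x, y}"
      using that assms by (intro digitally_connected_pair) (auto dest: symp_onD)
    moreover have "{x, y} \<subseteq> X"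
      using that by simp
    ultimately have "digitally_connected \<mu> (f ` {x, y})"
      using cont unfolding digitally_continuous_def by blast
    then show ?thesis
      using digitally_connected_pairD[of \<mu> "f x" "f y"] by auto
  qed
  moreover have "f ` X \<subseteq> Y"
    using cont by (simp add: digitally_continuous_def)
  ultimately show "f ` X \<subseteq> Y \<and> (\<forall>x\<in>X. \<forall>y\<in>X. \<kappa> x y \<longrightarrow> f x = f y \<or> \<mu> (f x) (f y))"
    by simp
next
  assume *: "f ` X \<subseteq> Y \<and> (\<forall>x\<in>X. \<forall>y\<in>X. \<kappa> x y \<longrightarrow> f x = f y \<or> \<mu> (f x) (f y))"
  have "digitally_connected \<mu> (f ` A)" if "A \<subseteq> X" "digitally_connected \<kappa> A" for A
    using that(2) by (rule digitally_connected_image) (use * that(1) in \<open>simp add: subset_iff\<close>)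
  with * show "digitally_continuous X \<kappa> Y \<mu> f"
    by (simp add: digitally_continuous_def)
qed

section \<open>Gluing continuous maps along a wedge point\<close>

lemma digitally_continuous_mono:
  assumes "digitally_continuous X \<kappa> Y \<mu> f" "Y \<subseteq> Z"
  shows "digitally_continuous X \<kappa> Z \<mu> f"
  using assms unfolding digitally_continuous_def by blast

lemma digitally_continuous_cong:
  assumes "\<And>x. x \<in> X \<Longrightarrow> f x = g x"
  shows "digitally_continuous X \<kappa> Y \<mu> f \<longleftrightarrow> digitally_continuous X \<kappa> Y \<mu> g"
proof -
  have "f ` A = g ` A" if "A \<subseteq> X" for A
    using that assms by (intro image_cong) auto
  then show ?thesis
    unfolding digitally_continuous_def by auto
qed

text \<open>Stated for a single function on all of \<open>X\<close>, so that it applies directly to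
  the end maps and to every time slice of a homotopy.\<close>

lemma digitally_continuous_wedge:
  assumes img: "digital_image X1 \<kappa>" "digital_image X2 \<kappa>"
    and wedge: "digital_wedge \<kappa> X1 X2 x0 X"
    and f: "digitally_continuous X1 \<kappa> Y \<mu> f" "digitally_continuous X2 \<kappa> Y \<mu> f"
  shows "digitally_continuous X \<kappa> Y \<mu> f"
proof -
  have sym: "symp_on X1 \<kappa>" "symp_on X2 \<kappa>" "symp_on X \<kappa>"
    using img digital_image_wedge[OF img wedge] by (auto simp: digital_image_def)
  have un: "X = X1 \<union> X2"
    and cross: "\<And>x y. x \<in> X1 - {x0} \<Longrightarrow> y \<in> X2 - {x0} \<Longrightarrow> \<not> \<kappa> x y \<and> \<not> \<kappa> y x"
    and x0: "x0 \<in> X1" "x0 \<in> X2"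
    using wedge by (auto simp: digital_wedge_def)
  have adj: "f x = f y \<or> \<mu> (f x) (f y)"
    if xy: "x \<in> X" "y \<in> X" "\<kappa> x y" for x y
  proof -
    \<comment> \<open>Otherwise \<open>x\<close> and \<open>y\<close> lie in different halves and
      neither is \<open>x0\<close>, which belongs to both; the wedge forbids adjacency between such
      points.\<close>
    consider "x \<in> X1" "y \<in> X1" | "x \<in> X2" "y \<in> X2"
      using x0 cross xy unfolding un by blast
    then show ?thesis
      using f xy(3) by cases (simp_all add: digitally_continuous_iff_adj sym)
  qed
  have "f ` X \<subseteq> Y"
    using f by (simp add: un image_Un digitally_continuous_def)
  with adj show ?thesis
    by (simp add: digitally_continuous_iff_adj sym)
qed

text \<open>The left map takes precedence on the overlap. In a wedge the overlap is just the wedge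
  point, so this choice is harmless once the two maps agree there.\<close>

definition wedge_map :: "'a set \<Rightarrow> ('a \<Rightarrow> 'b) \<Rightarrow> ('a \<Rightarrow> 'b) \<Rightarrow> 'a \<Rightarrow> 'b" where
  "wedge_map X1 f1 f2 x = (if x \<in> X1 then f1 x else f2 x)"

lemma wedge_map_left [simp]: "x \<in> X1 \<Longrightarrow> wedge_map X1 f1 f2 x = f1 x"
  by (simp add: wedge_map_def)

lemma wedge_map_right:
  assumes "digital_wedge \<kappa> X1 X2 x0 X" "f1 x0 = f2 x0" "x \<in> X2"
  shows "wedge_map X1 f1 f2 x = f2 x"
  using assms unfolding wedge_map_def digital_wedge_def by auto

lemma digitally_continuous_wedge_map:
  assumes img: "digital_image X1 \<kappa>" "digital_image X2 \<kappa>"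
    and wedge: "digital_wedge \<kappa> X1 X2 x0 X"
    and f: "digitally_continuous X1 \<kappa> Y1 \<mu> f1" "digitally_continuous X2 \<kappa> Y2 \<mu> f2"
    and eq: "f1 x0 = f2 x0"
  shows "digitally_continuous X \<kappa> (Y1 \<union> Y2) \<mu> (wedge_map X1 f1 f2)"
proof (rule digitally_continuous_wedge[OF img wedge])
  have "digitally_continuous X1 \<kappa> Y1 \<mu> (wedge_map X1 f1 f2)"
    using f(1) by (subst digitally_continuous_cong[where g = f1]) auto
  then show "digitally_continuous X1 \<kappa> (Y1 \<union> Y2) \<mu> (wedge_map X1 f1 f2)"
    by (rule digitally_continuous_mono) simp
  have "digitally_continuous X2 \<kappa> Y2 \<mu> (wedge_map X1 f1 f2)"
    using f(2) wedge_map_right[of \<kappa> X1 X2 x0 X f1 f2, OF wedge eq]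
    by (subst digitally_continuous_cong[where g = f2]) auto
  then show "digitally_continuous X2 \<kappa> (Y1 \<union> Y2) \<mu> (wedge_map X1 f1 f2)"
    by (rule digitally_continuous_mono) simp
qed

section \<open>Gluing long homotopies\<close>

lemma long_homotopy_mono:
  assumes "long_homotopy X \<kappa> Y \<mu> f g F" "Y \<subseteq> Z"
  shows "long_homotopy X \<kappa> Z \<mu> f g F"
  using assms unfolding long_homotopy_def by (auto intro: digitally_continuous_mono)

lemma long_homotopy_cong:
  assumes "\<And>x. x \<in> X \<Longrightarrow> f x = f' x" "\<And>x. x \<in> X \<Longrightarrow> g x = g' x" "\<And>x. x \<in> X \<Longrightarrow> F x = F' x"
  shows "long_homotopy X \<kappa> Y \<mu> f g F \<longleftrightarrow> long_homotopy X \<kappa> Y \<mu> f' g' F'"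
proof -
  have "digitally_continuous X \<kappa> Y \<mu> f \<longleftrightarrow> digitally_continuous X \<kappa> Y \<mu> f'"
    and "digitally_continuous X \<kappa> Y \<mu> g \<longleftrightarrow> digitally_continuous X \<kappa> Y \<mu> g'"
    and "\<And>t. digitally_continuous X \<kappa> Y \<mu> (\<lambda>x. F x t) \<longleftrightarrow> digitally_continuous X \<kappa> Y \<mu> (\<lambda>x. F' x t)"
    by (intro digitally_continuous_cong; simp add: assms)+
  then show ?thesis
    unfolding long_homotopy_def using assms by simp
qed

text \<open>The bound \<open>N\<close> and the continuity in time are conditions on each point
  \<open>x\<close> separately, so they pass to the union without any uniform bound. Only the end
  maps and the time slices need gluing of continuous maps.\<close>

lemma long_homotopy_wedge:
  assumes img: "digital_image X1 \<kappa>" "digital_image X2 \<kappa>"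
    and wedge: "digital_wedge \<kappa> X1 X2 x0 X"
    and F: "long_homotopy X1 \<kappa> Y \<mu> f g F" "long_homotopy X2 \<kappa> Y \<mu> f g F"
  shows "long_homotopy X \<kappa> Y \<mu> f g F"
proof -
  have "X = X1 \<union> X2"
    using wedge by (simp add: digital_wedge_def)
  then show ?thesis
    using F digitally_continuous_wedge[OF img wedge, where Y = Y and \<mu> = \<mu>]
    unfolding long_homotopy_def by (simp add: ball_Un)
qed

text \<open>The end maps \<open>f\<close> and \<open>g\<close> are prescribed only by their
  restrictions to the two halves, so that composites of glued maps and \<open>id\<close> both
  fit.\<close>

lemma pointed_long_homotopic_wedge:
  assumes img: "digital_image X1 \<kappa>" "digital_image X2 \<kappa>"
    and wedge: "digital_wedge \<kappa> X1 X2 x0 X"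
    and h: "pointed_long_homotopic X1 \<kappa> x0 Y1 \<mu> y0 f1 g1"
      "pointed_long_homotopic X2 \<kappa> x0 Y2 \<mu> y0 f2 g2"
    and f: "\<And>x. x \<in> X1 \<Longrightarrow> f x = f1 x" "\<And>x. x \<in> X2 \<Longrightarrow> f x = f2 x"
    and g: "\<And>x. x \<in> X1 \<Longrightarrow> g x = g1 x" "\<And>x. x \<in> X2 \<Longrightarrow> g x = g2 x"
  shows "pointed_long_homotopic X \<kappa> x0 (Y1 \<union> Y2) \<mu> y0 f g"
proof -
  obtain F1 F2 where F1: "long_homotopy X1 \<kappa> Y1 \<mu> f1 g1 F1" "\<And>t. F1 x0 t = y0"
    and F2: "long_homotopy X2 \<kappa> Y2 \<mu> f2 g2 F2" "\<And>t. F2 x0 t = y0"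
    using h unfolding pointed_long_homotopic_def by auto
  have x0: "x0 \<in> X1" "x0 \<in> X" "y0 \<in> Y1"
    using h wedge by (auto simp: pointed_long_homotopic_def digital_wedge_def)
  \<comment> \<open>The glued values are whole time tracks, functions of \<open>t\<close>. The
    tracks \<open>F1 x0\<close> and \<open>F2 x0\<close> coincide because both are constantly
    \<open>y0\<close>; this is where pointedness enters.\<close>
  define F where "F = wedge_map X1 F1 F2"
  have F: "\<And>x. x \<in> X1 \<Longrightarrow> F x = F1 x" "\<And>x. x \<in> X2 \<Longrightarrow> F x = F2 x"
    using wedge_map_right[OF wedge, of F1 F2] F1(2) F2(2) by (auto simp: F_def fun_eq_iff)
  have "long_homotopy X1 \<kappa> Y1 \<mu> f g F" "long_homotopy X2 \<kappa> Y2 \<mu> f g F"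
    using F1(1) F2(1) long_homotopy_cong[of X1 f f1 g g1 F F1, OF f(1) g(1) F(1)]
      long_homotopy_cong[of X2 f f2 g g2 F F2, OF f(2) g(2) F(2)] by simp_all
  then have "long_homotopy X \<kappa> (Y1 \<union> Y2) \<mu> f g F"
    by (intro long_homotopy_wedge[OF img wedge]) (auto intro: long_homotopy_mono)
  moreover have "\<forall>t. F x0 t = y0"
    using F(1) F1(2) x0 by simp
  ultimately show ?thesis
    using x0 unfolding pointed_long_homotopic_def by blast
qed

text \<open>Each half of \<open>X\<close> is sent into the matching half of \<open>Y\<close>, where
  the second glued map restricts to \<open>g1\<close> or \<open>g2\<close>. Hence the composite
  restricts to \<open>g1 \<circ> f1\<close> and \<open>g2 \<circ> f2\<close>, whose homotopies to
  \<open>id\<close> can be glued.\<close>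

lemma pointed_long_homotopic_wedge_map_comp:
  assumes img: "digital_image X1 \<kappa>" "digital_image X2 \<kappa>"
    and wedge: "digital_wedge \<kappa> X1 X2 x0 X" "digital_wedge \<mu> Y1 Y2 y0 Y"
    and f: "digitally_continuous X1 \<kappa> Y1 \<mu> f1" "digitally_continuous X2 \<kappa> Y2 \<mu> f2"
      "f1 x0 = y0" "f2 x0 = y0"
    and g: "g1 y0 = x0" "g2 y0 = x0"
    and h: "pointed_long_homotopic X1 \<kappa> x0 X1 \<kappa> x0 (g1 \<circ> f1) id"
      "pointed_long_homotopic X2 \<kappa> x0 X2 \<kappa> x0 (g2 \<circ> f2) id"
  shows "pointed_long_homotopic X \<kappa> x0 X \<kappa> x0 (wedge_map Y1 g1 g2 \<circ> wedge_map X1 f1 f2) id"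
proof -
  have into: "\<And>x. x \<in> X1 \<Longrightarrow> f1 x \<in> Y1" "\<And>x. x \<in> X2 \<Longrightarrow> f2 x \<in> Y2"
    using f(1,2) by (auto simp: digitally_continuous_def)
  have "pointed_long_homotopic X \<kappa> x0 (X1 \<union> X2) \<kappa> x0
    (wedge_map Y1 g1 g2 \<circ> wedge_map X1 f1 f2) id"
    by (rule pointed_long_homotopic_wedge[OF img wedge(1) h])
       (use f g into in \<open>auto simp: wedge_map_right[OF wedge(1)] wedge_map_right[OF wedge(2)]\<close>)
  then show ?thesis
    using wedge(1) by (simp add: digital_wedge_def)
qed

theorem theorem8p2:
  fixes X1 X2 X :: "(int ^ 'm) set" and \<kappa> :: "int ^ 'm \<Rightarrow> int ^ 'm \<Rightarrow> bool" and x0 :: "int ^ 'm"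
    and Y1 Y2 Y :: "(int ^ 'n) set" and \<mu> :: "int ^ 'n \<Rightarrow> int ^ 'n \<Rightarrow> bool" and y0 :: "int ^ 'n"
  assumes "digital_image X1 \<kappa>" and "digital_image X2 \<kappa>"
    and "digital_image Y1 \<mu>" and "digital_image Y2 \<mu>"
    and "digital_wedge \<kappa> X1 X2 x0 X"
    and "digital_wedge \<mu> Y1 Y2 y0 Y"
    and "same_pointed_long_homotopy_type X1 \<kappa> x0 Y1 \<mu> y0"
    and "same_pointed_long_homotopy_type X2 \<kappa> x0 Y2 \<mu> y0"
  shows "same_pointed_long_homotopy_type X \<kappa> x0 Y \<mu> y0"
proof -
  note X = assms(1,2,5) and Y = assms(3,4,6)
  obtain f1 g1 where 1: "digitally_continuous X1 \<kappa> Y1 \<mu> f1" "digitally_continuous Y1 \<mu> X1 \<kappa> g1"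
      "f1 x0 = y0" "g1 y0 = x0"
      "pointed_long_homotopic X1 \<kappa> x0 X1 \<kappa> x0 (g1 \<circ> f1) id"
      "pointed_long_homotopic Y1 \<mu> y0 Y1 \<mu> y0 (f1 \<circ> g1) id"
    using assms(7) unfolding same_pointed_long_homotopy_type_def by blast
  obtain f2 g2 where 2: "digitally_continuous X2 \<kappa> Y2 \<mu> f2" "digitally_continuous Y2 \<mu> X2 \<kappa> g2"
      "f2 x0 = y0" "g2 y0 = x0"
      "pointed_long_homotopic X2 \<kappa> x0 X2 \<kappa> x0 (g2 \<circ> f2) id"
      "pointed_long_homotopic Y2 \<mu> y0 Y2 \<mu> y0 (f2 \<circ> g2) id"
    using assms(8) unfolding same_pointed_long_homotopy_type_def by blast
  have sets: "X = X1 \<union> X2" "Y = Y1 \<union> Y2" "x0 \<in> X1" "y0 \<in> Y1"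
    using X(3) Y(3) by (auto simp: digital_wedge_def)
  let ?f = "wedge_map X1 f1 f2" and ?g = "wedge_map Y1 g1 g2"
  have "digitally_continuous X \<kappa> Y \<mu> ?f" "digitally_continuous Y \<mu> X \<kappa> ?g"
    using digitally_continuous_wedge_map[OF X 1(1) 2(1)]
      digitally_continuous_wedge_map[OF Y 1(2) 2(2)] 1(3,4) 2(3,4) sets by simp_all
  moreover have "?f x0 = y0" "?g y0 = x0"
    using 1(3,4) sets by simp_all
  moreover have "pointed_long_homotopic X \<kappa> x0 X \<kappa> x0 (?g \<circ> ?f) id"
    by (rule pointed_long_homotopic_wedge_map_comp[OF X Y(3) 1(1) 2(1) 1(3) 2(3) 1(4) 2(4) 1(5) 2(5)])
  \<comment> \<open>The same argument with the two wedges, and the two directions of the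
    equivalences, exchanged.\<close>
  moreover have "pointed_long_homotopic Y \<mu> y0 Y \<mu> y0 (?f \<circ> ?g) id"
    by (rule pointed_long_homotopic_wedge_map_comp[OF Y X(3) 1(2) 2(2) 1(4) 2(4) 1(3) 2(3) 1(6) 2(6)])
  ultimately show ?thesis
    using sets unfolding same_pointed_long_homotopy_type_def by blast
qed

end
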